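(* Let $M\ge 2$, $N\ge 2$, $H\ge H_0\ge 1$ be integers, let $A_0\in \mathrm{S}(M,H_0,K_0)$ and $B_0\in \mathrm{S}(H_0,N,K_0)$ be true stochastic matrices giving the minimal factorization of $A_0B_0$, and let $A\in\mathrm{S}(M,H,K)$, $B\in\mathrm{S}(H,N,K)$ be the parameter matrices. Let $\lambda_{SMF}$ be the real log canonical threshold of stochastic matrix factorization (the RLCT of $\|AB-A_0B_0\|^2$) and let $\lambda_{LDA}$ be the real log canonical threshold of latent Dirichlet allocation (the RLCT of $\mathrm{KL}(A,B)$). Then $\lambda_{SMF}=\lambda_{LDA}$.
   Context: A stochastic matrix is a matrix with non-negative entries each of whose columns sums to $1$. Let $K\subset[0,1]$ and $K_0\subset(0,1)$ be compact. $\mathrm{S}(M,N,E)$ denotes the set of $M\times N$ stochastic matrices with entries in $E\subset[0,1]$. Convention: a stochastic matrix with a single row is the all-ones row, so if $H_0=1$ (resp. $H=1$) then $B_0$ (resp. $B$) is the all-ones row and the entry condition $K_0$ (resp. $K$) is dropped for it. Minimal factorization means that $A_0B_0$ cannot be written as a product of two stochastic matrices with inner dimension smaller than $H_0$. It is also assumed that $\{(a,b,a^0,b^0)\in K^2\times K_0^2 : ab=a^0b^0\}\neq\emptyset$. Integrals $dA$, $dB$ over sets of stochastic matrices are with respect to Lebesgue measure in the free coordinates $a_{ik}$ ($1\le i\le M-1$, $1\le k\le H$) and $b_{kj}$ ($1\le k\le H-1$, $1\le j\le N$). $\mathrm{Onehot}(n)$ is the set of the $n$ standard unit vectors in $\{0,1\}^n$.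 For $x\in\mathrm{Onehot}(M)$ (word) and $z\in\mathrm{Onehot}(N)$ (document), the LDA true distribution and learning machine are $$q(x|z)=\prod_{j=1}^N\Big(\sum_{k=1}^{H_0}b^0_{kj}\prod_{i=1}^M(a^0_{ik})^{x_i}\Big)^{z_j},\qquad p(x|z,A,B)=\prod_{j=1}^N\Big(\sum_{k=1}^{H}b_{kj}\prod_{i=1}^M(a_{ik})^{x_i}\Big)^{z_j},$$ where $A=(a_{ik})$, $B=(b_{kj})$, $A_0=(a^0_{ik})$, $B_0=(b^0_{kj})$. Let $q'(z)$ be a positive, bounded probability distribution on $\mathrm{Onehot}(N)$ and $$\mathrm{KL}(A,B)=\sum_{z\in\mathrm{Onehot}(N)}\sum_{x\in\mathrm{Onehot}(M)}q(x|z)q'(z)\log\frac{q(x|z)}{p(x|z,A,B)}.$$ For a non-negative function $f(A,B)$, the zeta function $\zeta(z)=\int_{\mathrm{S}(M,H,K)}dA\int_{\mathrm{S}(H,N,K)}dB\, f(A,B)^z$, $\mathrm{Re}(z)>0$, continues to a meromorphic function on $\mathbb{C}$ whose poles are negative rationals; if its largest pole is $-\lambda$, then $\lambda$ is the RLCT of $f$. The RLCT of LDA is that of $f=\mathrm{KL}$; the RLCT of SMF is that of $f=\|AB-A_0B_0\|^2$, where $\|\cdot\|^2$ is the sum of squares of the entries. *)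

theory Defs
  imports "HOL-Complex_Analysis.Complex_Analysis" "Jordan_Normal_Form.Matrix"
begin

(* HOL-Analysis also uses the infix $; free it for vectors of Jordan_Normal_Form. *)
unbundle no vec_syntax

(* Matrices are those of Jordan_Normal_Form, hence indexed from 0. *)

definition stochastic :: "real mat \<Rightarrow> bool" where
  "stochastic A \<longleftrightarrow>
     (\<forall>i<dim_row A. \<forall>j<dim_col A. 0 \<le> A $$ (i, j)) \<and>
     (\<forall>j<dim_col A. (\<Sum>i<dim_row A. A $$ (i, j)) = 1)"

(* A stochastic matrix with a single row is the all-ones row; the condition that
   its entries lie in E is dropped. *)
definition stoch_mats :: "nat \<Rightarrow> nat \<Rightarrow> real set \<Rightarrow> real mat set" where
  "stoch_mats m n E =
     {A \<in> carrier_mat m n. stochastic A \<and>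
        (m = 1 \<or> (\<forall>i<m. \<forall>j<n. A $$ (i, j) \<in> E))}"

definition minimal_factorization :: "real mat \<Rightarrow> real mat \<Rightarrow> bool" where
  "minimal_factorization A B \<longleftrightarrow>
     \<not> (\<exists>h<dim_col A. \<exists>A'\<in>carrier_mat (dim_row A) h. \<exists>B'\<in>carrier_mat h (dim_col B).
           stochastic A' \<and> stochastic B' \<and> A * B = A' * B')"

(* Lebesgue measure in the free coordinates of an m x n stochastic matrix, i.e. all
   entries but those of the last row. For m = 1 it is the unit mass on one point. *)
definition free_lebesgue :: "nat \<Rightarrow> nat \<Rightarrow> (nat \<times> nat \<Rightarrow> real) measure" where
  "free_lebesgue m n = (\<Pi>\<^sub>M ij\<in>{..<m - 1} \<times> {..<n}. lborel)"

definition mat_of_free :: "nat \<Rightarrow> nat \<Rightarrow> (nat \<times> nat \<Rightarrow> real) \<Rightarrow> real mat" where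
  "mat_of_free m n u =
     Matrix.mat m n (\<lambda>(i, j). if i < m - 1 then u (i, j) else 1 - (\<Sum>l<m - 1. u (l, j)))"

definition free_domain :: "nat \<Rightarrow> nat \<Rightarrow> real set \<Rightarrow> (nat \<times> nat \<Rightarrow> real) set" where
  "free_domain m n E =
     {u \<in> space (free_lebesgue m n). mat_of_free m n u \<in> stoch_mats m n E}"

definition zeta_converges ::
  "nat \<Rightarrow> nat \<Rightarrow> nat \<Rightarrow> real set \<Rightarrow> (real mat \<Rightarrow> real mat \<Rightarrow> real) \<Rightarrow> complex \<Rightarrow> bool" where
  "zeta_converges M H N K f s \<longleftrightarrow>
     set_integrable (free_lebesgue M H \<Otimes>\<^sub>M free_lebesgue H N)
       (free_domain M H K \<times> free_domain H N K)
       (\<lambda>(u, v). complex_of_real (f (mat_of_free M H u) (mat_of_free H N v)) powr s)"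

definition zeta_integral ::
  "nat \<Rightarrow> nat \<Rightarrow> nat \<Rightarrow> real set \<Rightarrow> (real mat \<Rightarrow> real mat \<Rightarrow> real) \<Rightarrow> complex \<Rightarrow> complex" where
  "zeta_integral M H N K f s =
     set_lebesgue_integral (free_lebesgue M H) (free_domain M H K) (\<lambda>u.
       set_lebesgue_integral (free_lebesgue H N) (free_domain H N K) (\<lambda>v.
         complex_of_real (f (mat_of_free M H u) (mat_of_free H N v)) powr s))"

(* lam is the RLCT of f: the zeta function of f, defined for Re s > 0, has a meromorphic
   continuation Z to the complex plane, and -lam is the largest pole of Z. *)
definition is_RLCT ::
  "nat \<Rightarrow> nat \<Rightarrow> nat \<Rightarrow> real set \<Rightarrow> (real mat \<Rightarrow> real mat \<Rightarrow> real) \<Rightarrow> real \<Rightarrow> bool" where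
  "is_RLCT M H N K f lam \<longleftrightarrow>
     (\<exists>Z. Z meromorphic_on UNIV \<and>
          (\<forall>s. 0 < Re s \<longrightarrow> zeta_converges M H N K f s \<and> Z s = zeta_integral M H N K f s) \<and>
          is_pole Z (complex_of_real (- lam)) \<and>
          (\<forall>p. is_pole Z p \<longrightarrow> Re p \<le> - lam))"

definition sq_norm_mat :: "real mat \<Rightarrow> real" where
  "sq_norm_mat D = (\<Sum>i<dim_row D. \<Sum>j<dim_col D. (D $$ (i, j))\<^sup>2)"

definition Onehot :: "nat \<Rightarrow> nat vec set" where
  "Onehot n = {unit_vec n i | i. i < n}"

(* Both the true distribution q(x|z) (at A0, B0) and the learning machine p(x|z,A,B). *)
definition lda_prob :: "real mat \<Rightarrow> real mat \<Rightarrow> nat vec \<Rightarrow> nat vec \<Rightarrow> real" where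
  "lda_prob A B x z =
     (\<Prod>j<dim_col B.
        (\<Sum>k<dim_col A. B $$ (k, j) * (\<Prod>i<dim_row A. (A $$ (i, k)) ^ (x $ i))) ^ (z $ j))"

(* If p(x|z,A,B) = 0 for some x, z then KL is infinite, while here 1/0 = 0 and ln 0 = 0.
   For stochastic A with at least two rows this happens only if some free coordinate,
   or the last entry of some column, vanishes: a null set, invisible to the zeta function. *)
definition KL_LDA ::
  "real mat \<Rightarrow> real mat \<Rightarrow> (nat vec \<Rightarrow> real) \<Rightarrow> real mat \<Rightarrow> real mat \<Rightarrow> real" where
  "KL_LDA A0 B0 q' A B =
     (\<Sum>z\<in>Onehot (dim_col B0). \<Sum>x\<in>Onehot (dim_row A0).
        lda_prob A0 B0 x z * q' z * ln (lda_prob A0 B0 x z / lda_prob A B x z))"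

end

theory Submission
  imports Defs
begin

text \<open>
  Landau's argument identifies the largest pole of \<open>\<integral> f^s\<close>: the continuation is holomorphic on the disc
  about a real \<open>c > 0\<close> that reaches \<open>-\<lambda>\<close>, and its Taylor coefficients at \<open>c\<close> are the integrals of
  \<open>f^c (ln f)^n / n!\<close>. Summing the even ones shows that \<open>\<integral> f^{-t}\<close> is finite for \<open>t < \<lambda>\<close>, while at
  \<open>t = \<lambda>\<close> finiteness would keep the continuation bounded along the real axis near its pole. Hence
  \<open>\<lambda>\<close> depends only on which negative powers of \<open>f\<close> are integrable.

  The squared norm \<open>F\<close> and the divergence \<open>G\<close> have the same integrable negative powers: almost
  everywhere \<open>c F \<le> G\<close> (through the Hellinger distance), and \<open>G \<le> C F\<close> where \<open>F\<close> is small
  (through the chi-square divergence). Where \<open>F\<close> is large \<open>G\<close> may be unbounded, but negative powers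
  of \<open>F\<close> are bounded there.
\<close>

subsection \<open>Zeta functions of nonnegative functions\<close>

text \<open>For \<open>y > 0\<close> the function \<open>t \<mapsto> exp (t * ln y)\<close> is
  monotone, so the sign of \<open>ln y\<close> decides which endpoint dominates. At zeros of
  \<open>f\<close> the convention \<open>0 powr t = 0\<close> applies: here and below they
  contribute nothing, even to negative powers.\<close>

lemma integrable_powr_between:
  fixes f :: "'a \<Rightarrow> real"
  assumes [measurable]: "f \<in> borel_measurable M"
    and a: "integrable M (\<lambda>x. f x powr a)" and b: "integrable M (\<lambda>x. f x powr b)"
    and "a \<le> t" "t \<le> b"
  shows "integrable M (\<lambda>x. f x powr t)"
    and "(\<integral>x. f x powr t \<partial>M) \<le> (\<integral>x. f x powr a \<partial>M) + (\<integral>x. f x powr b \<partial>M)"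
proof -
  have le: "f x powr t \<le> f x powr a + f x powr b" for x
  proof (cases "f x = 0")
    case False
    have "exp (t * ln (f x)) \<le> exp (a * ln (f x)) \<or> exp (t * ln (f x)) \<le> exp (b * ln (f x))"
      using assms(4,5) by (cases "ln (f x) \<ge> 0") (auto intro: mult_right_mono mult_right_mono_neg)
    with False show ?thesis
      unfolding powr_def
      by (smt (verit) exp_ge_zero)
  qed simp
  show "integrable M (\<lambda>x. f x powr t)"
    by (rule Bochner_Integration.integrable_bound[OF Bochner_Integration.integrable_add[OF a b]])
       (use le in auto)
  then show "(\<integral>x. f x powr t \<partial>M) \<le> (\<integral>x. f x powr a \<partial>M) + (\<integral>x. f x powr b \<partial>M)"
    unfolding Bochner_Integration.integral_add[OF a b, symmetric]
    using le a b by (intro integral_mono) auto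
qed

text \<open>One of the two summands on the right is the left side, according to the sign of
  \<open>ln y\<close>. The bound supplies the dominating function for the expansion about
  \<open>c\<close> with radius \<open>r\<close>.\<close>

lemma exp_abs_mult_powr_le:
  fixes y c r :: real
  assumes "0 \<le> y"
  shows "y powr c * exp (r * \<bar>ln y\<bar>) \<le> y powr (c + r) + y powr (c - r)"
proof (cases "y = 0")
  case False
  then have "y powr (c + r) = y powr c * exp (r * ln y)" "y powr (c - r) = y powr c * exp (- (r * ln y))"
    by (auto simp: powr_def algebra_simps simp flip: exp_add)
  then show ?thesis
    by (cases "ln y \<ge> 0") auto
qed simp

lemma complex_powr_eq_powr_times_exp:
  fixes y c :: real
  assumes "0 \<le> y"
  shows "complex_of_real y powr s = of_real (y powr c) * exp ((s - of_real c) * of_real (ln y))"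
proof (cases "y = 0")
  case False
  then have "complex_of_real y powr s = exp (s * of_real (ln y))"
    using assms by (simp add: powr_def Ln_of_real)
  also have "s * of_real (ln y) = of_real (c * ln y) + (s - of_real c) * complex_of_real (ln y)"
    by (simp add: algebra_simps)
  finally show ?thesis
    using False by (simp add: exp_add powr_def flip: exp_of_real)
qed simp

text \<open>Write \<open>f^s = f^c * exp ((s - c) * ln f)\<close> and integrate the exponential
  series term by term. On the whole closed disc of radius \<open>r\<close> the sum of the absolute
  values is at most \<open>f^(c + r) + f^(c - r)\<close>, so integrability at the two real end
  points of the disc suffices.\<close>

lemma
  fixes f :: "'a \<Rightarrow> real"
  assumes [measurable]: "f \<in> borel_measurable M" and nn: "\<And>x. 0 \<le> f x"
    and p: "integrable M (\<lambda>x. f x powr (c + r))" and m: "integrable M (\<lambda>x. f x powr (c - r))"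
    and r: "cmod (s - of_real c) \<le> r"
  shows powr_integral_sums:
    "(\<lambda>n. of_real (\<integral>x. f x powr c * ln (f x) ^ n / fact n \<partial>M) * (s - of_real c) ^ n) sums
       (\<integral>x. complex_of_real (f x) powr s \<partial>M)"
    and integrable_powr_ln_power: 
      "0 < r \<Longrightarrow> integrable M (\<lambda>x. f x powr c * ln (f x) ^ n / fact n)"
proof -
  have "0 \<le> r" using r norm_ge_zero order_trans by blast
  have dom: "integrable M (\<lambda>x. f x powr (c + r) + f x powr (c - r))"
    using p m by simp
  \<comment> \<open>The majorant of the \<open>n\<close>-th term: \<open>ln (f x)\<close> is
    replaced by its absolute value and \<open>\<bar>s - c\<bar>\<close> by \<open>r\<close>.\<close>
  define g where "g = (\<lambda>n x. f x powr c * (r * \<bar>ln (f x)\<bar>) ^ n / fact n)"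
  have g_sums: "(\<lambda>n. g n x) sums (f x powr c * exp (r * \<bar>ln (f x)\<bar>))" for x
    unfolding g_def using exp_converges[of "r * \<bar>ln (f x)\<bar>"]
    by (auto dest: sums_mult[of _ _ "f x powr c"] simp: field_simps)
  have g0: "0 \<le> g n x" for n x
    unfolding g_def using \<open>0 \<le> r\<close> by simp
  have partial: "(\<Sum>i\<in>I. g i x) \<le> f x powr (c + r) + f x powr (c - r)" if "finite I" for I x
    using sum_le_suminf[OF sums_summable[OF g_sums] that, of x] g0 sums_unique[OF g_sums, of x]
      exp_abs_mult_powr_le[OF nn, of x c r] by simp
  have [measurable]: "g n \<in> borel_measurable M" for n unfolding g_def by measurable
  have g_int: "integrable M (g n)" for n
    by (rule Bochner_Integration.integrable_bound[OF dom]) (use partial[of "{n}"] g0 in auto)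
  have g_summ: "summable (\<lambda>n. \<integral>x. g n x \<partial>M)"
  proof (rule summableI_nonneg_bounded)
    show "0 \<le> (\<integral>x. g n x \<partial>M)" for n using g0 by simp
    show "(\<Sum>i<n. \<integral>x. g i x \<partial>M) \<le> (\<integral>x. f x powr (c + r) + f x powr (c - r) \<partial>M)" for n
      unfolding Bochner_Integration.integral_sum[OF g_int, symmetric]
      by (intro integral_mono dom Bochner_Integration.integrable_sum g_int partial) simp
  qed
  \<comment> \<open>The absolute value of the coefficient is \<open>g n / r ^ n\<close>, hence the
    condition \<open>0 < r\<close>.\<close>
  show int: "integrable M (\<lambda>x. f x powr c * ln (f x) ^ n / fact n)" if "0 < r" for n
  proof -
    have "integrable M (\<lambda>x. g n x / r ^ n)" using g_int by simp
    then show ?thesis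
      by (rule Bochner_Integration.integrable_bound)
         (use that in \<open>auto simp: g_def abs_mult power_mult_distrib power_abs\<close>)
  qed
  define h where "h = (\<lambda>n x. complex_of_real (f x powr c * ln (f x) ^ n / fact n) * (s - of_real c) ^ n)"
  have h_sums: "(\<lambda>n. h n x) sums (complex_of_real (f x) powr s)" for x
  proof -
    have "h n x = complex_of_real (f x powr c) *
        (((s - of_real c) * complex_of_real (ln (f x))) ^ n /\<^sub>R fact n)" for n
      by (simp add: h_def scaleR_conv_of_real power_mult_distrib divide_inverse mult_ac)
    then show ?thesis
      unfolding complex_powr_eq_powr_times_exp[OF nn, of _ s c]
      by (simp only: sums_mult[OF exp_converges])
  qed
  have hg: "cmod (h n x) \<le> g n x" for n x
    using r mult_left_mono[OF power_mono[OF r norm_ge_zero, of n], of "f x powr c * \<bar>ln (f x)\<bar> ^ n / fact n"]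
    by (simp add: h_def g_def norm_mult norm_divide norm_power power_mult_distrib mult_ac abs_mult power_abs)
  have h_meas [measurable]: "h n \<in> borel_measurable M" for n unfolding h_def by measurable
  have h_int: "integrable M (h n)" for n
    by (rule Bochner_Integration.integrable_bound[OF g_int[of n]]) (use hg g0 in auto)
  have "(\<lambda>n. integral\<^sup>L M (h n)) sums (\<integral>x. (\<Sum>n. h n x) \<partial>M)"
  proof (rule sums_integral[OF h_int])
    show "AE x in M. summable (\<lambda>n. norm (h n x))"
      by (intro AE_I2 summable_comparison_test'[OF sums_summable[OF g_sums]]) (use hg in auto)
    show "summable (\<lambda>n. \<integral>x. norm (h n x) \<partial>M)"
      by (rule summable_comparison_test'[OF g_summ])
         (use hg h_int g_int in \<open>auto intro!: integral_mono\<close>)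
  qed
  also have "(\<lambda>n. integral\<^sup>L M (h n)) = (\<lambda>n. of_real (\<integral>x. f x powr c * ln (f x) ^ n / fact n \<partial>M) * (s - of_real c) ^ n)"
    unfolding h_def by (simp only: integral_mult_left_zero integral_complex_of_real)
  finally show "(\<lambda>n. of_real (\<integral>x. f x powr c * ln (f x) ^ n / fact n \<partial>M) * (s - of_real c) ^ n) sums
       (\<integral>x. complex_of_real (f x) powr s \<partial>M)"
    by (simp only: sums_unique[OF h_sums, symmetric])
qed

text \<open>Only the even coefficients enter, and these are nonnegative whatever the sign of
  \<open>ln f\<close>: so \<open>f\<close> may exceed \<open>1\<close>, unlike in the usual form of Landau's theorem.\<close>
lemma integrable_powr_of_summable:
  fixes f :: "'a \<Rightarrow> real"
  assumes [measurable]: "f \<in> borel_measurable M" and nn: "\<And>x. 0 \<le> f x" and "0 \<le> r"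
    and int: "\<And>n. integrable M (\<lambda>x. f x powr c * ln (f x) ^ n / fact n)"
    and summ: "summable (\<lambda>n. \<bar>\<integral>x. f x powr c * ln (f x) ^ n / fact n \<partial>M\<bar> * r ^ n)"
  shows "integrable M (\<lambda>x. f x powr (c - r))"
proof -
  \<comment> \<open>The even terms at distance \<open>r\<close> from \<open>c\<close>. Their sum is
    \<open>f^c * cosh (r * ln f)\<close>, and twice this dominates
    \<open>f^c * exp (- r * ln f) = f^(c - r)\<close>.\<close>
  define g where "g = (\<lambda>n x. if even n then f x powr c * ln (f x) ^ n / fact n * r ^ n else 0)"
  have g0: "0 \<le> g n x" for n x
    using \<open>0 \<le> r\<close> by (auto simp: g_def zero_le_even_power)
  have g_sums: "(\<lambda>n. g n x) sums (f x powr c * cosh (r * ln (f x)))" for x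
  proof -
    have "g n x = f x powr c * (if even n then (r * ln (f x)) ^ n /\<^sub>R fact n else 0)" for n
      by (simp add: g_def field_simps)
    then show ?thesis
      using cosh_converges[of "r * ln (f x)"] by (auto intro: sums_mult)
  qed
  have g_int: "integrable M (g n)" for n
    unfolding g_def using integrable_mult_left[OF int[of n], of "r ^ n"] by (cases "even n") auto
  have "integrable M (\<lambda>x. \<Sum>n. g n x)"
  proof (rule integrable_suminf[OF g_int])
    show "AE x in M. summable (\<lambda>n. norm (g n x))"
      using g0 sums_summable[OF g_sums] by (intro AE_I2) simp
    have "norm (\<integral>x. norm (g n x) \<partial>M) \<le> \<bar>\<integral>x. f x powr c * ln (f x) ^ n / fact n \<partial>M\<bar> * r ^ n" for n
    proof -
      have "(\<integral>x. norm (g n x) \<partial>M) = (\<integral>x. g n x \<partial>M)" using g0 by simp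
      also have "\<dots> \<le> \<bar>\<integral>x. f x powr c * ln (f x) ^ n / fact n \<partial>M\<bar> * r ^ n"
        using \<open>0 \<le> r\<close> by (cases "even n") (auto simp: g_def intro!: mult_right_mono)
      finally show ?thesis by simp
    qed
    then show "summable (\<lambda>n. \<integral>x. norm (g n x) \<partial>M)"
      by (intro summable_comparison_test'[OF summ]) auto
  qed
  then have "integrable M (\<lambda>x. 2 * (f x powr c * cosh (r * ln (f x))))"
    using sums_unique[OF g_sums] by simp
  then show ?thesis
  proof (rule Bochner_Integration.integrable_bound)
    have "f x powr (c - r) \<le> 2 * (f x powr c * cosh (r * ln (f x)))" for x
    proof (cases "f x = 0")
      case False
      then have "f x powr (c - r) = f x powr c * exp (- (r * ln (f x)))"
        by (auto simp: powr_def algebra_simps simp flip: exp_add)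
      also have "\<dots> \<le> f x powr c * (2 * cosh (r * ln (f x)))"
        by (intro mult_left_mono) (auto simp: cosh_def)
      finally show ?thesis by simp
    qed simp
    then show "AE x in M. norm (f x powr (c - r)) \<le> norm (2 * (f x powr c * cosh (r * ln (f x))))"
      by (intro AE_I2) (auto intro: order_trans[OF _ abs_ge_self])
  qed measurable
qed

section \<open>The largest pole decides which powers are integrable\<close>

text \<open>A meromorphic function may carry arbitrary values at removable singularities, so absence
  of poles alone does not make it holomorphic. Its singularities are never essential; those that are
  not poles are removable.\<close>

lemma remove_sings_holomorphic_on:
  assumes "Z meromorphic_on A" "open A" "\<And>z. z \<in> A \<Longrightarrow> \<not> is_pole Z z"
  shows "remove_sings Z holomorphic_on A"
proof -
  have "remove_sings Z analytic_on {z}" if "z \<in> A" for z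
    using assms(1,3) that remove_sings_analytic_at
    by (meson meromorphic_on_isolated_singularity meromorphic_on_not_essential not_essential_def
        meromorphic_on_subset empty_subsetI insert_subset)
  then show ?thesis
    using analytic_imp_holomorphic analytic_on_analytic_at by blast
qed

text \<open>The right-hand side of the equivalence characterizes \<open>lam\<close> by
  \<open>f\<close> alone, without the continuation \<open>Z\<close>. This is what allows two zeta
  functions to be compared through pointwise bounds.\<close>

lemma zeta_largest_pole:
  fixes f :: "'a \<Rightarrow> real"
  assumes [measurable]: "f \<in> borel_measurable M" and nn: "\<And>x. 0 \<le> f x"
    and mero: "Z meromorphic_on UNIV"
    and zeta: "\<And>s. 0 < Re s \<Longrightarrow> integrable M (\<lambda>x. complex_of_real (f x) powr s)"
      "\<And>s. 0 < Re s \<Longrightarrow> Z s = (\<integral>x. complex_of_real (f x) powr s \<partial>M)"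
    and pole: "is_pole Z (complex_of_real (- lam))"
    and largest: "\<And>p. is_pole Z p \<Longrightarrow> Re p \<le> - lam"
  shows "integrable M (\<lambda>x. f x powr (- t)) \<longleftrightarrow> t < lam"
proof -
  have conv: "integrable M (\<lambda>x. f x powr t)" if "0 < t" for t
    using zeta(1)[of "of_real t"] that nn by (simp add: powr_of_real complex_of_real_integrable_eq)
  \<comment> \<open>The expansion point is positive, lies to the right of \<open>- lam\<close>, and
    satisfies \<open>c + t > 0\<close>, so that \<open>- t\<close> is reached by going left from
    \<open>c\<close>.\<close>
  define c where "c = \<bar>lam\<bar> + \<bar>t\<bar> + 1"
  have c: "0 < c" "0 < c + lam" "\<bar>t\<bar> < c" by (auto simp: c_def)
  define a where "a = (\<lambda>n. \<integral>x. f x powr c * ln (f x) ^ n / fact n \<partial>M)"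
  define Y where "Y = remove_sings Z"
  \<comment> \<open>The disc of radius \<open>c\<close> about \<open>c\<close> lies in the
    half-plane \<open>Re s > 0\<close>, where \<open>Z\<close> is the integral.\<close>
  have series_Z: "(\<lambda>n. of_real (a n) * (s - of_real c) ^ n) sums Z s" if "s \<in> ball (of_real c) c" for s
  proof -
    define r where "r = cmod (s - of_real c)"
    have r: "r < c" "0 \<le> r" using that by (auto simp: dist_commute dist_norm r_def)
    moreover have "0 < Re s" using that abs_Re_le_cmod[of "s - of_real c"] r by (auto simp: r_def)
    ultimately show ?thesis
      unfolding a_def zeta(2)[OF \<open>0 < Re s\<close>] using c
      by (intro powr_integral_sums[where r = r] conv nn) (auto simp flip: r_def)
  qed
  have hol_Z: "Z holomorphic_on ball (of_real c) c"
    by (rule power_series_holomorphic) (rule series_Z)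
  have Y_eq: "Y s = Z s" if "s \<in> ball (of_real c) c" for s
    unfolding Y_def using hol_Z that
    by (intro remove_sings_at_analytic) (auto simp: analytic_at intro!: exI[of _ "ball (of_real c) c"])
  \<comment> \<open>Every point of this disc has real part above \<open>- lam\<close>, where no pole
    can lie.\<close>
  have hol_Y: "Y holomorphic_on ball (of_real c) (c + lam)"
    unfolding Y_def
  proof (rule remove_sings_holomorphic_on)
    show "\<not> is_pole Z z" if "z \<in> ball (complex_of_real c) (c + lam)" for z
    proof
      assume "is_pole Z z"
      then have "Re z \<le> - lam" by (rule largest)
      moreover have "\<bar>Re z - c\<bar> < c + lam"
        using that abs_Re_le_cmod[of "z - of_real c"] by (auto simp: dist_norm norm_minus_commute)
      ultimately show False by linarith
    qed
  qed (use mero in \<open>auto intro: meromorphic_on_subset\<close>)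
  \<comment> \<open>Near \<open>c\<close> the continuation and the integral agree, so by uniqueness
    of power series the integrals \<open>a n\<close> are the Taylor coefficients of
    \<open>Y\<close>, and the series converges on the disc that reaches
    \<open>- lam\<close>.\<close>
  have coeff: "(deriv ^^ n) Y (of_real c) / fact n = of_real (a n)" for n
  proof -
    have "Y analytic_on {of_real c}"
      using hol_Y c by (auto simp: analytic_at intro!: exI[of _ "ball (of_real c) (c + lam)"])
    then have "(\<lambda>x. Y (of_real c + x)) has_fps_expansion fps_expansion Y (of_real c)"
      by (rule analytic_at_imp_has_fps_expansion)
    moreover have "(\<lambda>x. Y (of_real c + x)) has_fps_expansion Abs_fps (\<lambda>n. of_real (a n))"
    proof (rule has_fps_expansionI)
      have "eventually (\<lambda>u. u \<in> ball 0 c) (nhds (0::complex))"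
        using c by (intro eventually_nhds_in_open) auto
      then show "\<forall>\<^sub>F u in nhds 0. (\<lambda>n. fps_nth (Abs_fps (\<lambda>n. of_real (a n))) n * u ^ n) sums Y (of_real c + u)"
      proof eventually_elim
        case (elim u)
        then have "of_real c + u \<in> ball (of_real c) c" by (simp add: dist_norm)
        from series_Z[OF this] Y_eq[OF this] show ?case by simp
      qed
    qed
    ultimately have "fps_expansion Y (of_real c) = Abs_fps (\<lambda>n. of_real (a n))"
      by (rule fps_expansion_unique_complex)
    then have "fps_nth (fps_expansion Y (of_real c)) n = of_real (a n)" by simp
    then show ?thesis by (simp add: fps_expansion_def)
  qed
  have series_Y: "(\<lambda>n. of_real (a n) * (s - of_real c) ^ n) sums Y s"
    if "s \<in> ball (of_real c) (c + lam)" for s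
    using holomorphic_power_series[OF hol_Y that] by (simp add: coeff)
  have int_c: "integrable M (\<lambda>x. f x powr c * ln (f x) ^ n / fact n)" for n
    using c by (intro integrable_powr_ln_power[where r = "c / 2" and s = "of_real c"] conv nn) auto
  have int_less: "integrable M (\<lambda>x. f x powr (- t))" if "t < lam"
  proof -
    define r where "r = c + t"
    \<comment> \<open>Convergence at the larger radius \<open>R\<close>, still inside the disc,
      gives absolute convergence at \<open>r\<close>, where \<open>c - r = - t\<close>.\<close>
    define R where "R = (r + (c + lam)) / 2"
    have r: "0 \<le> r" "r < R" "R < c + lam" using that c by (auto simp: r_def R_def)
    have "summable (\<lambda>n. complex_of_real (a n) * (of_real (c + R) - of_real c) ^ n)"
      by (rule sums_summable[OF series_Y]) (use r in \<open>auto simp: dist_norm\<close>)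
    then have "summable (\<lambda>n. complex_of_real (a n) * of_real R ^ n)" by simp
    then have "summable (\<lambda>n. cmod (complex_of_real (a n) * of_real r ^ n))"
      by (rule powser_insidea) (use r in auto)
    then have "summable (\<lambda>n. \<bar>a n\<bar> * r ^ n)"
      using r by (simp add: norm_mult norm_power)
    then have "integrable M (\<lambda>x. f x powr (c - r))"
      unfolding a_def using r by (intro integrable_powr_of_summable int_c nn) auto
    then show ?thesis by (simp add: r_def)
  qed
  have no_int: "\<not> integrable M (\<lambda>x. f x powr (- lam))"
  proof
    assume int: "integrable M (\<lambda>x. f x powr (- lam))"
    have "lam < c" "- lam < c" by (auto simp: c_def)
    \<comment> \<open>The exponent \<open>c + (c + lam)\<close> is the mirror image of
      \<open>- lam\<close> in \<open>c\<close>. Every disc about \<open>c\<close> of radius below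
      \<open>c + lam\<close> has its real end points between these two exponents, and
      \<open>B\<close> bounds the integrals of all powers in between.\<close>
    define B where "B = (\<integral>x. f x powr (- lam) \<partial>M) + (\<integral>x. f x powr (c + (c + lam)) \<partial>M)"
    have bound: "cmod (Y (of_real t)) \<le> B" if t: "- lam < t" "t < c" for t
    proof -
      have int': "integrable M (\<lambda>x. f x powr (c + (c + lam)))" using conv c by simp
      \<comment> \<open>The series is evaluated at the left end point of its closed disc, so that
        \<open>f^t\<close> is itself one of the two dominating powers.\<close>
      define r where "r = c - t"
      have eq: "c - r = t" and r: "0 < r" "r < c + lam" using t by (auto simp: r_def)
      note int_t = integrable_powr_between[OF assms(1) int int']
      have "(\<lambda>n. of_real (a n) * (of_real t - of_real c) ^ n) sums
              (\<integral>x. complex_of_real (f x) powr (of_real t) \<partial>M)"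
        unfolding a_def
      proof (intro powr_integral_sums[where r = r] nn)
        show "cmod (of_real t - of_real c) \<le> r"
          using t by (simp add: r_def flip: of_real_diff)
      qed (use t eq r c conv in \<open>auto intro!: int_t\<close>)
      moreover have "(\<lambda>n. of_real (a n) * (of_real t - of_real c) ^ n) sums Y (of_real t)"
        using t by (intro series_Y) (auto simp: dist_norm simp flip: of_real_diff)
      ultimately have "Y (of_real t) = (\<integral>x. complex_of_real (f x) powr (of_real t) \<partial>M)"
        using sums_unique2 by blast
      also have "\<dots> = of_real (\<integral>x. f x powr t \<partial>M)"
        using nn by (simp add: powr_of_real)
      finally have "cmod (Y (of_real t)) = (\<integral>x. f x powr t \<partial>M)" by simp
      also have "\<dots> \<le> B" unfolding B_def using t c by (intro int_t) auto
      finally show ?thesis .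
    qed
    have "\<forall>\<^sub>F s in at (complex_of_real (- lam)). B + 1 \<le> cmod (Z s)"
      using pole unfolding is_pole_def filterlim_at_infinity_conv_norm_at_top filterlim_at_top
      by (rule spec)
    moreover have "\<forall>\<^sub>F s in at (complex_of_real (- lam)). Y s = Z s"
      unfolding Y_def using mero
      by (intro eventually_remove_sings_eq_at meromorphic_on_isolated_singularity)
         (auto intro: meromorphic_on_subset)
    ultimately have "\<forall>\<^sub>F s in at (complex_of_real (- lam)). B + 1 \<le> cmod (Y s)"
      by eventually_elim simp
    then obtain d where d: "d > 0" "\<And>s. s \<noteq> of_real (- lam) \<Longrightarrow> dist s (of_real (- lam)) < d \<Longrightarrow> B + 1 \<le> cmod (Y s)"
      unfolding eventually_at by auto
    \<comment> \<open>The real point \<open>- lam + e\<close> is close enough to the pole for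
      \<open>\<bar>Y\<bar> \<ge> B + 1\<close> and still left of \<open>c\<close>, where
      \<open>\<bar>Y\<bar> \<le> B\<close>.\<close>
    define e where "e = min (d / 2) ((c + lam) / 2)"
    have e: "0 < e" "e < d" "e < c + lam" using d c by (auto simp: e_def min_def)
    have "B + 1 \<le> cmod (Y (of_real (- lam + e)))"
      using e by (intro d) (auto simp: dist_norm)
    moreover have "cmod (Y (of_real (- lam + e))) \<le> B" using e by (intro bound) auto
    ultimately show False by simp
  qed
  show ?thesis
  proof
    assume int: "integrable M (\<lambda>x. f x powr (- t))"
    show "t < lam"
    proof (rule ccontr)
      assume "\<not> t < lam"
      then have "integrable M (\<lambda>x. f x powr (- lam))"
        using c by (intro integrable_powr_between(1)[OF assms(1) int conv[of "c"]]) (auto simp: c_def)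
      with no_int show False by simp
    qed
  qed (rule int_less)
qed

section \<open>Comparable functions have the same largest pole\<close>

text \<open>The conditions of \<open>is_RLCT\<close> for one function on one measure space: the
  iterated integral and the matrices are gone.\<close>

definition largest_zeta_pole :: "'a measure \<Rightarrow> ('a \<Rightarrow> real) \<Rightarrow> real \<Rightarrow> bool" where
  "largest_zeta_pole M f lam \<longleftrightarrow>
     (\<exists>Z. Z meromorphic_on UNIV \<and>
          (\<forall>s. 0 < Re s \<longrightarrow> integrable M (\<lambda>x. complex_of_real (f x) powr s) \<and>
                 Z s = (\<integral>x. complex_of_real (f x) powr s \<partial>M)) \<and>
          is_pole Z (complex_of_real (- lam)) \<and>
          (\<forall>p. is_pole Z p \<longrightarrow> Re p \<le> - lam))"

text \<open>Used to replace the divergence by its absolute value. The two differ only on a null set,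
  where the conventions \<open>1 / 0 = 0\<close> and \<open>ln 0 = 0\<close> can make the sum
  negative.\<close>

lemma largest_zeta_pole_cong_AE:
  assumes "largest_zeta_pole M f lam" and [measurable]: "f \<in> borel_measurable M" "g \<in> borel_measurable M"
    and ae: "AE x in M. f x = g x"
  shows "largest_zeta_pole M g lam"
proof -
  have "AE x in M. complex_of_real (f x) powr s = complex_of_real (g x) powr s" for s
    using ae by eventually_elim simp
  then have "integrable M (\<lambda>x. complex_of_real (f x) powr s) \<longleftrightarrow> integrable M (\<lambda>x. complex_of_real (g x) powr s)"
    and "(\<integral>x. complex_of_real (f x) powr s \<partial>M) = (\<integral>x. complex_of_real (g x) powr s \<partial>M)" for s
    by (rule integrable_cong_AE[rotated 2] integral_cong_AE[rotated 2]; measurable)+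
  then show ?thesis using assms(1) unfolding largest_zeta_pole_def by simp
qed

lemma largest_zeta_pole_integrable_iff:
  assumes "largest_zeta_pole M f lam" "f \<in> borel_measurable M" "\<And>x. 0 \<le> f x"
  shows "integrable M (\<lambda>x. f x powr (- t)) \<longleftrightarrow> t < lam"
proof -
  obtain Z where Z: "Z meromorphic_on UNIV" "is_pole Z (complex_of_real (- lam))"
    "\<And>s. 0 < Re s \<Longrightarrow> integrable M (\<lambda>x. complex_of_real (f x) powr s)"
    "\<And>s. 0 < Re s \<Longrightarrow> Z s = (\<integral>x. complex_of_real (f x) powr s \<partial>M)"
    "\<And>p. is_pole Z p \<Longrightarrow> Re p \<le> - lam"
    using assms(1) unfolding largest_zeta_pole_def by blast
  show ?thesis
    by (rule zeta_largest_pole[OF assms(2,3) Z(1,3,4,2,5)])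
qed

lemma largest_zeta_pole_unique_of_comparable:
  fixes F G :: "'a \<Rightarrow> real"
  assumes "finite_measure M"
    and [measurable]: "F \<in> borel_measurable M" "G \<in> borel_measurable M"
    and F: "\<And>x. 0 \<le> F x"
    and lower: "AE x in M. c * F x \<le> G x"
    and upper: "AE x in M. F x < d \<longrightarrow> G x \<le> C * F x"
    and pos: "0 < c" "0 < C" "0 < d"
    and poles: "largest_zeta_pole M F lam" "largest_zeta_pole M G lam'"
  shows "lam = lam'"
proof -
  interpret finite_measure M by fact
  define G' where "G' = (\<lambda>x. \<bar>G x\<bar>)"
  have [measurable]: "G' \<in> borel_measurable M" by (simp add: G'_def)
  have "AE x in M. G x = G' x"
    using lower
  proof eventually_elim
    case (elim x)
    then have "0 \<le> G x" using F[of x] \<open>0 < c\<close> by (meson mult_nonneg_nonneg less_imp_le order_trans)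
    then show ?case by (simp add: G'_def)
  qed
  then have "largest_zeta_pole M G' lam'"
    by (rule largest_zeta_pole_cong_AE[OF poles(2), rotated 2]; measurable)
  then have int_G: "integrable M (\<lambda>x. G' x powr (- t)) \<longleftrightarrow> t < lam'" for t
    by (rule largest_zeta_pole_integrable_iff) (auto simp: G'_def)
  have int_F: "integrable M (\<lambda>x. F x powr (- t)) \<longleftrightarrow> t < lam" for t
    by (rule largest_zeta_pole_integrable_iff[OF poles(1)]) (auto simp: F)
  \<comment> \<open>The power with exponent \<open>0\<close> is the indicator of
    \<open>h x \<noteq> 0\<close>, integrable over a finite measure. Hence both thresholds are
    positive and only \<open>t > 0\<close> has to be compared.\<close>
  have "integrable M (\<lambda>x. h x powr (- 0))" if [measurable]: "h \<in> borel_measurable M" for h :: "'a \<Rightarrow> real"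
    by (rule integrable_const_bound[of _ 1]) (auto simp: powr_def)
  then have lam: "0 < lam" "0 < lam'"
    using int_F[of 0] int_G[of 0] by auto
  have "t < lam \<longleftrightarrow> t < lam'" if t: "0 < t" for t
  proof
    assume "t < lam"
    then have "integrable M (\<lambda>x. c powr (- t) * F x powr (- t))"
      using int_F by simp
    then have "integrable M (\<lambda>x. G' x powr (- t))"
    proof (rule Bochner_Integration.integrable_bound)
      show "AE x in M. norm (G' x powr (- t)) \<le> norm (c powr (- t) * F x powr (- t))"
        using lower upper
      proof eventually_elim
        case (elim x)
        show ?case
        \<comment> \<open>Where \<open>F x = 0\<close> the two bounds force \<open>G x = 0\<close>,
          so by convention both powers vanish.\<close>
        proof (cases "F x = 0")
          case False
          then have "0 < c * F x" using F[of x] pos by simp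
          then have "G' x powr (- t) \<le> (c * F x) powr (- t)"
            using elim t by (intro powr_mono2') (auto simp: G'_def)
          then show ?thesis using F[of x] pos by (simp add: powr_mult)
        qed (use elim pos in \<open>auto simp: G'_def\<close>)
      qed
    qed measurable
    then show "t < lam'" using int_G by simp
  next
    assume "t < lam'"
    \<comment> \<open>The first summand inverts \<open>G \<le> C * F\<close> where
      \<open>F < d\<close>; the constant covers the points with \<open>F \<ge> d\<close>.\<close>
    then have "integrable M (\<lambda>x. C powr t * G' x powr (- t) + d powr (- t))"
      using int_G by simp
    then have "integrable M (\<lambda>x. F x powr (- t))"
    proof (rule Bochner_Integration.integrable_bound)
      show "AE x in M. norm (F x powr (- t)) \<le> norm (C powr t * G' x powr (- t) + d powr (- t))"
        using lower upper
      proof eventually_elim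
        case (elim x)
        have "F x powr (- t) \<le> C powr t * G' x powr (- t) + d powr (- t)"
        proof (cases "F x = 0 \<or> F x \<ge> d")
          case True
          then show ?thesis
          proof
            assume "F x \<ge> d"
            then have "F x powr (- t) \<le> d powr (- t)" using pos t by (intro powr_mono2') auto
            then show ?thesis by (simp add: add_increasing)
          qed (simp add: add_nonneg_nonneg)
        next
          case False
          then have "0 < c * F x" "F x < d" using F[of x] pos by auto
          then have G: "0 < G' x" "G' x \<le> C * F x" using elim by (auto simp: G'_def)
          then have "(C * F x) powr (- t) \<le> G' x powr (- t)" using t by (intro powr_mono2') auto
          then have "C powr t * (C powr (- t) * F x powr (- t)) \<le> C powr t * G' x powr (- t)"
            using F[of x] pos by (intro mult_left_mono) (auto simp: powr_mult)
          moreover have "C powr t * C powr (- t) = 1"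
            using pos by (simp flip: powr_add)
          ultimately have "F x powr (- t) \<le> C powr t * G' x powr (- t)"
            by (simp flip: mult.assoc)
          then show ?thesis by (simp add: add_increasing2)
        qed
        then show ?case by (simp add: add_nonneg_nonneg)
      qed
    qed measurable
    then show "t < lam" using int_F by simp
  qed
  \<comment> \<open>The choices \<open>t = lam\<close> and \<open>t = lam'\<close> exclude both
    strict inequalities.\<close>
  from this[of lam] this[of lam'] lam show ?thesis by auto
qed

subsection \<open>Kullback-Leibler divergence and squared distance\<close>

text \<open>With \<open>a = sqrt p\<close> and \<open>b = sqrt q\<close>, the inequality
  \<open>ln x \<le> x - 1\<close> at \<open>x = a / b\<close> bounds the divergence below by the sum
  of \<open>(a - b)^2\<close>. Since \<open>p - q = (a + b) * (a - b)\<close> and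
  \<open>a + b \<le> 2\<close>, this costs a factor \<open>4\<close>.\<close>

lemma KL_ge_sq_dist:
  fixes p q :: "'i \<Rightarrow> real"
  assumes pos: "\<And>i. i \<in> I \<Longrightarrow> 0 < p i" "\<And>i. i \<in> I \<Longrightarrow> 0 < q i" and "finite I"
    and sum: "sum p I = 1" "sum q I = 1"
  shows "(\<Sum>i\<in>I. (p i - q i)\<^sup>2) / 4 \<le> (\<Sum>i\<in>I. q i * ln (q i / p i))"
proof -
  \<comment> \<open>The correction \<open>q i - p i\<close> makes the bound hold term by term; it
    sums to zero.\<close>
  have le: "(p i - q i)\<^sup>2 / 4 + (q i - p i) \<le> q i * ln (q i / p i)" if "i \<in> I" for i
  proof -
    define a b where "a = sqrt (p i)" and "b = sqrt (q i)"
    have ab: "0 < a" "0 < b" "a\<^sup>2 = p i" "b\<^sup>2 = q i"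
      using pos[OF that] by (auto simp: a_def b_def)
    have "p i \<le> 1" "q i \<le> 1"
      using sum member_le_sum[OF that, of p] member_le_sum[OF that, of q] \<open>finite I\<close> pos by fastforce+
    then have "a \<le> 1" "b \<le> 1" by (auto simp: a_def b_def)
    then have "(a + b)\<^sup>2 \<le> 2\<^sup>2" using ab by (intro power_mono) auto
    moreover have "p i - q i = (a + b) * (a - b)"
      using ab by (simp add: algebra_simps power2_eq_square)
    ultimately have sq_le: "(p i - q i)\<^sup>2 / 4 \<le> (a - b)\<^sup>2"
      using mult_right_mono[of "(a + b)\<^sup>2" "2\<^sup>2" "(a - b)\<^sup>2"] by (simp add: power_mult_distrib)
    have "ln (p i / q i) = 2 * ln (a / b)"
      using ab by (simp add: ln_div ln_realpow flip: ab(3,4))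
    also have "\<dots> \<le> 2 * (a / b - 1)"
      using ab by (intro mult_left_mono ln_le_minus_one) auto
    finally have "ln (q i / p i) \<ge> 2 * (1 - a / b)"
      using pos[OF that] by (simp add: ln_div)
    then have "b\<^sup>2 * (2 * (1 - a / b)) \<le> q i * ln (q i / p i)"
      unfolding ab(4) using pos[OF that] by (intro mult_left_mono) auto
    also have "b\<^sup>2 * (2 * (1 - a / b)) = (a - b)\<^sup>2 + (b\<^sup>2 - a\<^sup>2)"
      using ab by (simp add: field_simps power2_eq_square)
    finally show ?thesis using sq_le ab by simp
  qed
  have "(\<Sum>i\<in>I. (p i - q i)\<^sup>2) / 4 = (\<Sum>i\<in>I. (p i - q i)\<^sup>2 / 4 + (q i - p i))"
    by (simp add: sum.distrib sum_subtractf sum sum_divide_distrib)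
  also have "\<dots> \<le> (\<Sum>i\<in>I. q i * ln (q i / p i))"
    by (intro sum_mono le)
  finally show ?thesis .
qed

text \<open>The inequality \<open>ln x \<le> x - 1\<close> at \<open>x = q / p\<close> bounds the
  divergence by the sum of \<open>(p - q)^2 / p\<close>, again up to terms \<open>q - p\<close> of
  total zero.\<close>

lemma KL_le_sq_dist:
  fixes p q :: "'i \<Rightarrow> real"
  assumes "0 < d" "\<And>i. i \<in> I \<Longrightarrow> d \<le> p i" "\<And>i. i \<in> I \<Longrightarrow> 0 < q i"
    and sum: "sum p I = 1" "sum q I = 1"
  shows "(\<Sum>i\<in>I. q i * ln (q i / p i)) \<le> (\<Sum>i\<in>I. (p i - q i)\<^sup>2) / d"
proof -
  have le: "q i * ln (q i / p i) \<le> (p i - q i)\<^sup>2 / d + (q i - p i)" if "i \<in> I" for i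
  proof -
    have p: "0 < p i" "d \<le> p i" "0 < q i" using assms(1-3) that by force+
    then have "q i * ln (q i / p i) \<le> q i * (q i / p i - 1)"
      by (intro mult_left_mono ln_le_minus_one) auto
    also have "\<dots> = (p i - q i)\<^sup>2 / p i + (q i - p i)"
      using p by (simp add: field_simps power2_eq_square)
    also have "(p i - q i)\<^sup>2 / p i \<le> (p i - q i)\<^sup>2 / d"
      using p assms(1) by (intro divide_left_mono) auto
    finally show ?thesis by simp
  qed
  have "(\<Sum>i\<in>I. q i * ln (q i / p i)) \<le> (\<Sum>i\<in>I. (p i - q i)\<^sup>2 / d + (q i - p i))"
    by (intro sum_mono le)
  also have "\<dots> = (\<Sum>i\<in>I. (p i - q i)\<^sup>2) / d"
    by (simp add: sum.distrib sum_subtractf sum sum_divide_distrib)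
  finally show ?thesis .
qed

section \<open>Products of stochastic matrices\<close>

lemma index_mult_mat_sum:
  assumes "A \<in> carrier_mat m h" "B \<in> carrier_mat h n" "i < m" "j < n"
  shows "(A * B) $$ (i, j) = (\<Sum>k<h. A $$ (i, k) * B $$ (k, j))"
  using assms by (auto simp: scalar_prod_def lessThan_atLeast0 intro!: sum.cong)

lemma stochastic_column_sum:
  assumes "A \<in> carrier_mat m n" "stochastic A" "j < n"
  shows "(\<Sum>i<m. A $$ (i, j)) = 1"
  using assms by (auto simp: stochastic_def)

lemma stochastic_nonneg:
  assumes "A \<in> carrier_mat m n" "stochastic A" "i < m" "j < n"
  shows "0 \<le> A $$ (i, j)"
  using assms by (auto simp: stochastic_def)

lemma stochastic_mult:
  assumes "A \<in> carrier_mat m h" "B \<in> carrier_mat h n" "stochastic A" "stochastic B"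
  shows "stochastic (A * B)"
proof -
  have "0 \<le> (A * B) $$ (i, j)" if "i < m" "j < n" for i j
    using that assms by (auto simp: index_mult_mat_sum[OF assms(1,2) that] stochastic_def intro!: sum_nonneg)
  moreover have "(\<Sum>i<m. (A * B) $$ (i, j)) = 1" if "j < n" for j
  proof -
    have "(\<Sum>i<m. (A * B) $$ (i, j)) = (\<Sum>k<h. (\<Sum>i<m. A $$ (i, k)) * B $$ (k, j))"
      using that by (simp add: index_mult_mat_sum[OF assms(1,2)] sum_distrib_right sum.swap[of _ "{..<h}"])
    also have "\<dots> = (\<Sum>k<h. B $$ (k, j))"
      using stochastic_column_sum[OF assms(1,3)] by simp
    also have "\<dots> = 1" using stochastic_column_sum[OF assms(2,4)] that by simp
    finally show ?thesis .
  qed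
  ultimately show ?thesis using assms(1,2) by (auto simp: stochastic_def)
qed

text \<open>Each column of \<open>B\<close> is nonnegative with sum \<open>1\<close>, so it has a
  positive entry. Positivity is asked of \<open>A\<close> only, which also covers a single-row
  \<open>B\<close>, whose entries are not free.\<close>

lemma mult_mat_pos:
  assumes "A \<in> carrier_mat m h" "B \<in> carrier_mat h n" "stochastic B"
    and "\<And>i k. i < m \<Longrightarrow> k < h \<Longrightarrow> 0 < A $$ (i, k)" and "i < m" "j < n"
  shows "0 < (A * B) $$ (i, j)"
proof -
  have nn: "0 \<le> A $$ (i, k) * B $$ (k, j)" if "k < h" for k
    using assms that stochastic_nonneg[OF assms(2,3) that assms(6)] by (simp add: less_imp_le)
  have "\<exists>k<h. B $$ (k, j) \<noteq> 0"
    using stochastic_column_sum[OF assms(2,3,6)] by (metis lessThan_iff sum.neutral zero_neq_one)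
  then obtain k where k: "k < h" "0 < B $$ (k, j)"
    using stochastic_nonneg[OF assms(2,3) _ assms(6)] by force
  then have "0 < A $$ (i, k) * B $$ (k, j)" using assms by simp
  then show ?thesis
    using nn k by (auto simp: index_mult_mat_sum[OF assms(1,2,5,6)] intro!: sum_pos2)
qed

section \<open>LDA in matrix form\<close>

lemma sum_Onehot: "(\<Sum>z\<in>Onehot n. g z) = (\<Sum>i<n. g (unit_vec n i))"
proof -
  have "Onehot n = unit_vec n ` {..<n}" by (auto simp: Onehot_def)
  moreover have "inj_on (unit_vec n :: nat \<Rightarrow> nat vec) {..<n}" by (auto intro!: inj_onI)
  ultimately show ?thesis by (simp add: sum.reindex)
qed

text \<open>One-hot exponents turn all factors but one into \<open>1\<close>. This is the link
  between LDA and matrix factorization.\<close>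

lemma lda_prob_unit_vec:
  assumes "A \<in> carrier_mat m h" "B \<in> carrier_mat h n" "i < m" "j < n"
  shows "lda_prob A B (unit_vec m i) (unit_vec n j) = (A * B) $$ (i, j)"
proof -
  have "lda_prob A B (unit_vec m i) (unit_vec n j) =
      (\<Prod>j'<n. (\<Sum>k<h. B $$ (k, j') * A $$ (i, k)) ^ (if j' = j then 1 else 0))"
    unfolding lda_prob_def using assms
    by (intro prod.cong arg_cong2[where f = "(^)"] sum.cong arg_cong2[where f = "(*)"])
       (auto simp: prod.delta if_distrib[of "\<lambda>e. _ ^ e"] cong: if_cong)
  also have "\<dots> = (\<Sum>k<h. B $$ (k, j) * A $$ (i, k))"
    using assms by (simp add: if_distrib[of "\<lambda>e. _ ^ e"] prod.delta cong: if_cong)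
  finally show ?thesis by (simp add: index_mult_mat_sum[OF assms] mult.commute)
qed

text \<open>The columns of both products are word distributions, so the divergence is a weighted sum
  of columnwise divergences.\<close>

lemma KL_LDA_altdef:
  assumes "A0 \<in> carrier_mat M H0" "B0 \<in> carrier_mat H0 N" "A \<in> carrier_mat M H" "B \<in> carrier_mat H N"
  shows "KL_LDA A0 B0 q' A B = (\<Sum>j<N. q' (unit_vec N j) *
           (\<Sum>i<M. (A0 * B0) $$ (i, j) * ln ((A0 * B0) $$ (i, j) / (A * B) $$ (i, j))))"
proof -
  have "KL_LDA A0 B0 q' A B = (\<Sum>j<N. \<Sum>i<M. lda_prob A0 B0 (unit_vec M i) (unit_vec N j) * q' (unit_vec N j) *
     ln (lda_prob A0 B0 (unit_vec M i) (unit_vec N j) / lda_prob A B (unit_vec M i) (unit_vec N j)))"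
    using assms unfolding KL_LDA_def sum_Onehot by auto
  also have "\<dots> = (\<Sum>j<N. \<Sum>i<M. (A0 * B0) $$ (i, j) * q' (unit_vec N j) *
     ln ((A0 * B0) $$ (i, j) / (A * B) $$ (i, j)))"
    by (intro sum.cong refl) (simp add: lda_prob_unit_vec[OF assms(1,2)] lda_prob_unit_vec[OF assms(3,4)])
  finally show ?thesis by (simp add: sum_distrib_left mult_ac)
qed

lemma sq_norm_mat_diff_mult:
  assumes "A0 \<in> carrier_mat M H0" "B0 \<in> carrier_mat H0 N" "A \<in> carrier_mat M H" "B \<in> carrier_mat H N"
  shows "sq_norm_mat (A * B - A0 * B0) = (\<Sum>j<N. \<Sum>i<M. ((A * B) $$ (i, j) - (A0 * B0) $$ (i, j))\<^sup>2)"
proof -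
  have "sq_norm_mat (A * B - A0 * B0) = (\<Sum>i<M. \<Sum>j<N. ((A * B) $$ (i, j) - (A0 * B0) $$ (i, j))\<^sup>2)"
    unfolding sq_norm_mat_def using assms by (auto intro!: sum.cong)
  then show ?thesis by (subst sum.swap)
qed

text \<open>The columnwise bounds are summed over documents. The constants depend only on the least
  entry of \<open>A0 * B0\<close> and the least document weight, hence are uniform in
  \<open>A\<close> and \<open>B\<close>.\<close>

lemma KL_LDA_comparable_sq_norm:
  assumes "0 < M" "0 < N"
    and A0: "A0 \<in> carrier_mat M H0" "stochastic A0" "\<And>i k. i < M \<Longrightarrow> k < H0 \<Longrightarrow> 0 < A0 $$ (i, k)"
    and B0: "B0 \<in> carrier_mat H0 N" "stochastic B0"
    and q': "\<And>z. z \<in> Onehot N \<Longrightarrow> 0 < q' z" "(\<Sum>z\<in>Onehot N. q' z) = 1"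
  obtains c C d :: real where "0 < c" "0 < C" "0 < d"
    "\<And>H A B. A \<in> carrier_mat M H \<Longrightarrow> B \<in> carrier_mat H N \<Longrightarrow> stochastic A \<Longrightarrow> stochastic B \<Longrightarrow>
       (\<And>i j. i < M \<Longrightarrow> j < N \<Longrightarrow> 0 < (A * B) $$ (i, j)) \<Longrightarrow>
       c * sq_norm_mat (A * B - A0 * B0) \<le> KL_LDA A0 B0 q' A B \<and>
       (sq_norm_mat (A * B - A0 * B0) < d \<longrightarrow> KL_LDA A0 B0 q' A B \<le> C * sq_norm_mat (A * B - A0 * B0))"
proof -
  define w where "w = (\<lambda>j. q' (unit_vec N j))"
  define Q where "Q = (\<lambda>i j. (A0 * B0) $$ (i, j))"
  have w_pos: "0 < w j" if "j < N" for j using q'(1)[of "unit_vec N j"] that by (auto simp: Onehot_def w_def)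
  have w_sum: "(\<Sum>j<N. w j) = 1" using q'(2) by (simp add: sum_Onehot w_def)
  have w_le: "w j \<le> 1" if "j < N" for j
    using member_le_sum[of j "{..<N}" w] w_sum w_pos that by (auto simp: less_imp_le)
  define wm where "wm = Min (w ` {..<N})"
  have wm: "0 < wm" "\<And>j. j < N \<Longrightarrow> wm \<le> w j"
    using w_pos \<open>0 < N\<close> by (auto simp: wm_def Min_gr_iff lessThan_empty_iff)
  have Q_pos: "0 < Q i j" if "i < M" "j < N" for i j
    unfolding Q_def using mult_mat_pos[OF A0(1) B0 A0(3) that] by simp
  have Q_sum: "(\<Sum>i<M. Q i j) = 1" if "j < N" for j
    unfolding Q_def using stochastic_mult[OF A0(1) B0(1) A0(2) B0(2)] A0(1) B0(1) that
    by (intro stochastic_column_sum[of _ _ N]) auto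
  define qm where "qm = Min (case_prod Q ` ({..<M} \<times> {..<N}))"
  have qm: "0 < qm" "\<And>i j. i < M \<Longrightarrow> j < N \<Longrightarrow> qm \<le> Q i j"
  proof -
    show "0 < qm" unfolding qm_def using Q_pos assms(1,2)
      by (subst Min_gr_iff) (auto simp: lessThan_empty_iff)
    show "qm \<le> Q i j" if "i < M" "j < N" for i j
      unfolding qm_def using that by (intro Min_le) force+
  qed
  show ?thesis
  \<comment> \<open>A squared norm below \<open>(qm / 2)^2\<close> moves each entry by less than
    \<open>qm / 2\<close>, so entries of \<open>A * B\<close> stay above \<open>qm / 2\<close>,
    whence \<open>2 / qm\<close>. The \<open>4\<close> in \<open>wm / 4\<close> comes from
    \<open>KL_ge_sq_dist\<close>.\<close>
  proof (rule that[of "wm / 4" "2 / qm" "(qm / 2)\<^sup>2"])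
    fix H A B
    assume A: "A \<in> carrier_mat M H" "stochastic A" and B: "B \<in> carrier_mat H N" "stochastic B"
      and pos: "\<And>i j. i < M \<Longrightarrow> j < N \<Longrightarrow> 0 < (A * B) $$ (i, j)"
    define P where "P = (\<lambda>i j. (A * B) $$ (i, j))"
    define F where "F = (\<lambda>j. \<Sum>i<M. (P i j - Q i j)\<^sup>2)"
    define G where "G = (\<lambda>j. \<Sum>i<M. Q i j * ln (Q i j / P i j))"
    have P_pos: "0 < P i j" if "i < M" "j < N" for i j using pos that by (simp add: P_def)
    have P_sum: "(\<Sum>i<M. P i j) = 1" if "j < N" for j
      unfolding P_def using stochastic_mult[OF A(1) B(1) A(2) B(2)] A(1) B(1) that
      by (intro stochastic_column_sum[of _ _ N]) auto
    have sq: "sq_norm_mat (A * B - A0 * B0) = (\<Sum>j<N. F j)"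
      unfolding F_def P_def Q_def by (rule sq_norm_mat_diff_mult[OF A0(1) B0(1) A(1) B(1)])
    have KL: "KL_LDA A0 B0 q' A B = (\<Sum>j<N. w j * G j)"
      unfolding G_def P_def Q_def w_def by (rule KL_LDA_altdef[OF A0(1) B0(1) A(1) B(1)])
    have F0: "0 \<le> F j" for j by (auto simp: F_def intro!: sum_nonneg)
    have G_ge: "F j / 4 \<le> G j" if "j < N" for j
      unfolding F_def G_def using that by (intro KL_ge_sq_dist P_pos Q_pos P_sum Q_sum) auto
    have "wm / 4 * F j \<le> w j * G j" if "j < N" for j
    proof -
      have "wm * (F j / 4) \<le> w j * G j"
        using wm w_pos[OF that] F0[of j] that G_ge[OF that] by (intro mult_mono) auto
      then show ?thesis by simp
    qed
    then have lower: "wm / 4 * sq_norm_mat (A * B - A0 * B0) \<le> KL_LDA A0 B0 q' A B"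
      unfolding sq KL sum_distrib_left by (intro sum_mono) auto
    have upper: "KL_LDA A0 B0 q' A B \<le> 2 / qm * sq_norm_mat (A * B - A0 * B0)"
      if small: "sq_norm_mat (A * B - A0 * B0) < (qm / 2)\<^sup>2"
    proof -
      have P_ge: "qm / 2 \<le> P i j" if "i < M" "j < N" for i j
      proof -
        have "(P i j - Q i j)\<^sup>2 \<le> F j"
          unfolding F_def using that by (intro member_le_sum) auto
        also have "\<dots> \<le> (\<Sum>j<N. F j)" using that F0 by (intro member_le_sum) auto
        also have "\<dots> < (qm / 2)\<^sup>2" using small sq by simp
        finally have "\<bar>P i j - Q i j\<bar> < qm / 2"
          using qm(1) by (intro power2_less_imp_less[of "\<bar>P i j - Q i j\<bar>"]) auto
        then show ?thesis using qm(2)[OF that] by linarith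
      qed
      have "w j * G j \<le> 2 / qm * F j" if "j < N" for j
      proof -
        have "G j \<le> F j / (qm / 2)"
          unfolding F_def G_def using that qm(1) by (intro KL_le_sq_dist P_ge Q_pos P_sum Q_sum) auto
        \<comment> \<open>Nonnegativity is what allows the weight \<open>w j \<le> 1\<close> to be
          dropped.\<close>
        moreover have "0 \<le> G j" using G_ge[OF that] F0[of j] by linarith
        then have "w j * G j \<le> 1 * G j" using w_le[OF that] by (intro mult_right_mono)
        ultimately show ?thesis by (simp add: mult.commute)
      qed
      then show ?thesis unfolding sq KL sum_distrib_left by (intro sum_mono) auto
    qed
    show "wm / 4 * sq_norm_mat (A * B - A0 * B0) \<le> KL_LDA A0 B0 q' A B \<and>
       (sq_norm_mat (A * B - A0 * B0) < (qm / 2)\<^sup>2 \<longrightarrow>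
        KL_LDA A0 B0 q' A B \<le> 2 / qm * sq_norm_mat (A * B - A0 * B0))"
      using lower upper by blast
  qed (use wm qm in auto)
qed

subsection \<open>The parameter space\<close>

abbreviation free_index :: "nat \<Rightarrow> nat \<Rightarrow> (nat \<times> nat) set" where
  "free_index m n \<equiv> {..<m - 1} \<times> {..<n}"

interpretation lborel_product: product_sigma_finite "\<lambda>_ :: nat \<times> nat. lborel :: real measure" ..

lemma sigma_finite_free_lebesgue: "sigma_finite_measure (free_lebesgue m n)"
  unfolding free_lebesgue_def by (rule lborel_product.sigma_finite) auto

lemma mat_of_free_carrier [simp]: "mat_of_free m n u \<in> carrier_mat m n"
  by (simp add: mat_of_free_def)

lemma index_mat_of_free:
  "i < m \<Longrightarrow> j < n \<Longrightarrow>
     mat_of_free m n u $$ (i, j) = (if i < m - 1 then u (i, j) else 1 - (\<Sum>l<m - 1. u (l, j)))"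
  by (simp add: mat_of_free_def)

lemma measurable_free_coordinate:
  "i < m - 1 \<Longrightarrow> j < n \<Longrightarrow> (\<lambda>u. u (i, j)) \<in> borel_measurable (free_lebesgue m n)"
  unfolding free_lebesgue_def
  using measurable_component_singleton[of "(i, j)" "free_index m n" "\<lambda>_. lborel"] by simp

lemma measurable_index_mat_of_free [measurable (raw)]:
  assumes [measurable]: "g \<in> measurable M (free_lebesgue m n)" and ij: "i < m" "j < n"
  shows "(\<lambda>x. mat_of_free m n (g x) $$ (i, j)) \<in> borel_measurable M"
proof -
  have "(\<lambda>u. mat_of_free m n u $$ (i, j)) \<in> borel_measurable (free_lebesgue m n)"
    unfolding index_mat_of_free[OF ij]
    by (cases "i < m - 1") (use ij in \<open>auto intro!: measurable_free_coordinate borel_measurable_sum borel_measurable_diff\<close>)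
  from measurable_compose[OF assms(1) this] show ?thesis .
qed

lemma free_domain_sets:
  assumes "compact E"
  shows "free_domain m n E \<in> sets (free_lebesgue m n)"
proof -
  have [measurable]: "E \<in> sets borel" using assms by (simp add: borel_compact)
  let ?L = "free_lebesgue m n"
  have X: "(\<lambda>u. mat_of_free m n u $$ (i, j)) \<in> borel_measurable ?L" if "i < m" "j < n" for i j
    using that by (intro measurable_index_mat_of_free) auto
  have "{u \<in> space ?L. 0 \<le> mat_of_free m n u $$ (i, j)} \<in> sets ?L"
    and "{u \<in> space ?L. mat_of_free m n u $$ (i, j) \<in> E} \<in> sets ?L" if "i < m" "j < n" for i j
    using X[OF that, measurable] by measurable
  moreover have "{u \<in> space ?L. (\<Sum>i<m. mat_of_free m n u $$ (i, j)) = 1} \<in> sets ?L" if "j < n" for j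
  proof -
    have "(\<lambda>u. \<Sum>i<m. mat_of_free m n u $$ (i, j)) \<in> borel_measurable ?L"
      using that by (intro borel_measurable_sum X) auto
    then show ?thesis by measurable
  qed
  ultimately have "{u \<in> space ?L.
      (\<forall>i\<in>{..<m}. \<forall>j\<in>{..<n}. 0 \<le> mat_of_free m n u $$ (i, j)) \<and>
      (\<forall>j\<in>{..<n}. (\<Sum>i<m. mat_of_free m n u $$ (i, j)) = 1) \<and>
      (m = 1 \<or> (\<forall>i\<in>{..<m}. \<forall>j\<in>{..<n}. mat_of_free m n u $$ (i, j) \<in> E))} \<in> sets ?L"
    by (intro sets.sets_Collect_conj sets.sets_Collect_disj sets.sets_Collect_const
          sets.sets_Collect_finite_All) auto
  moreover have "free_domain m n E = {u \<in> space ?L.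
      (\<forall>i\<in>{..<m}. \<forall>j\<in>{..<n}. 0 \<le> mat_of_free m n u $$ (i, j)) \<and>
      (\<forall>j\<in>{..<n}. (\<Sum>i<m. mat_of_free m n u $$ (i, j)) = 1) \<and>
      (m = 1 \<or> (\<forall>i\<in>{..<m}. \<forall>j\<in>{..<n}. mat_of_free m n u $$ (i, j) \<in> E))}"
    by (auto simp: free_domain_def stoch_mats_def stochastic_def Ball_def carrier_matD[OF mat_of_free_carrier])
  ultimately show ?thesis by simp
qed

lemma free_domain_stochastic: "u \<in> free_domain m n E \<Longrightarrow> stochastic (mat_of_free m n u)"
  by (simp add: free_domain_def stoch_mats_def)

text \<open>Nonnegative entries with column sum \<open>1\<close> put the free coordinates in the
  unit cube, of measure \<open>1\<close> (also when there are no free coordinates).\<close>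

lemma emeasure_free_domain:
  shows "emeasure (free_lebesgue m n) (free_domain m n E) \<le> 1"
proof -
  have "free_domain m n E \<subseteq> (\<Pi>\<^sub>E ij\<in>free_index m n. {0..1})"
  proof
    fix u assume u: "u \<in> free_domain m n E"
    note stoch = free_domain_stochastic[OF u]
    have "u (i, j) \<in> {0..1}" if ij: "i < m - 1" "j < n" for i j
    proof -
      have nn: "0 \<le> mat_of_free m n u $$ (l, j)" if "l < m" for l
        using stochastic_nonneg[OF mat_of_free_carrier stoch that ij(2)] .
      have "mat_of_free m n u $$ (i, j) \<le> (\<Sum>l<m. mat_of_free m n u $$ (l, j))"
        using ij nn by (intro member_le_sum) auto
      also have "\<dots> = 1" by (rule stochastic_column_sum[OF mat_of_free_carrier stoch ij(2)])
      finally show ?thesis using nn[of i] ij by (simp add: index_mat_of_free)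
    qed
    moreover have "u \<in> extensional (free_index m n)"
      using u by (simp add: free_domain_def free_lebesgue_def space_PiM PiE_def)
    ultimately show "u \<in> (\<Pi>\<^sub>E ij\<in>free_index m n. {0..1})" by (auto simp: PiE_def)
  qed
  then have "emeasure (free_lebesgue m n) (free_domain m n E)
      \<le> emeasure (free_lebesgue m n) (\<Pi>\<^sub>E ij\<in>free_index m n. {0..1})"
    by (intro emeasure_mono) (auto simp: free_lebesgue_def intro!: sets_PiM_I_finite)
  also have "\<dots> = 1"
    unfolding free_lebesgue_def by (subst lborel_product.emeasure_PiM) auto
  finally show ?thesis .
qed

text \<open>The last hypothesis says that \<open>g\<close> ignores coordinate \<open>k\<close>.
  Integrating that coordinate first, each fibre of the graph is a single point, so the graph is a
  null set.\<close>

lemma AE_PiM_lborel_neq: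
  fixes g :: "(nat \<times> nat \<Rightarrow> real) \<Rightarrow> real"
  assumes "finite I" "k \<in> I" and [measurable]: "g \<in> borel_measurable (Pi\<^sub>M I (\<lambda>_. lborel))"
    and g: "\<And>x y. g (x(k := y)) = g x"
  shows "AE x in Pi\<^sub>M I (\<lambda>_. lborel). x k \<noteq> g x"
proof -
  let ?P = "Pi\<^sub>M I (\<lambda>_. lborel :: real measure)"
  define J where "J = I - {k}"
  have J: "finite J" "k \<notin> J" "insert k J = I" using assms by (auto simp: J_def)
  have [measurable]: "(\<lambda>x. x k) \<in> borel_measurable ?P"
    using measurable_component_singleton[of k I "\<lambda>_. lborel"] assms by simp
  have meas: "(\<lambda>x. indicator {g x} (x k) :: ennreal) \<in> borel_measurable ?P"
  proof -
    have "{x \<in> space ?P. x k = g x} \<in> sets ?P" by measurable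
    then have "(\<lambda>x. indicator {x \<in> space ?P. x k = g x} x :: ennreal) \<in> borel_measurable ?P"
      by (rule borel_measurable_indicator)
    then show ?thesis by (rule measurable_cong[THEN iffD1, rotated]) (auto simp: indicator_def)
  qed
  have "(\<integral>\<^sup>+x. indicator {g x} (x k) \<partial>?P) =
      (\<integral>\<^sup>+x. (\<integral>\<^sup>+y. indicator {g (x(k := y))} ((x(k := y)) k) \<partial>lborel) \<partial>Pi\<^sub>M J (\<lambda>_. lborel))"
    using lborel_product.product_nn_integral_insert[OF J(1,2), of "\<lambda>x. indicator {g x} (x k)"] meas
    unfolding J(3) by blast
  also have "\<dots> = 0" by (simp add: g)
  finally have "AE x in ?P. indicator {g x} (x k) = (0::ennreal)"
    by (subst (asm) nn_integral_0_iff_AE) (use meas in auto)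
  then show ?thesis by eventually_elim (auto simp: indicator_def split: if_splits)
qed

lemma AE_mat_of_free_nonzero:
  assumes "2 \<le> m"
  shows "AE u in free_lebesgue m n. \<forall>i<m. \<forall>j<n. mat_of_free m n u $$ (i, j) \<noteq> 0"
proof -
  have "AE u in free_lebesgue m n. mat_of_free m n u $$ (i, j) \<noteq> 0" if ij: "i < m" "j < n" for i j
  proof (cases "i < m - 1")
    case True
    have "AE u in free_lebesgue m n. u (i, j) \<noteq> 0"
      unfolding free_lebesgue_def using True ij by (intro AE_PiM_lborel_neq) auto
    then show ?thesis using True ij by (simp add: index_mat_of_free)
  next
    case False
    \<comment> \<open>The dependent last entry vanishes exactly when the free coordinate
      \<open>(0, j)\<close>, present since \<open>m \<ge> 2\<close>, is this function of the
      others.\<close>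
    let ?g = "\<lambda>u :: nat \<times> nat \<Rightarrow> real. 1 - (\<Sum>l\<in>{..<m - 1} - {0}. u (l, j))"
    have "?g \<in> borel_measurable (free_lebesgue m n)"
      using ij by (auto intro!: borel_measurable_diff borel_measurable_sum measurable_free_coordinate)
    then have "AE u in free_lebesgue m n. u (0, j) \<noteq> ?g u"
      unfolding free_lebesgue_def using ij assms by (intro AE_PiM_lborel_neq) auto
    then show ?thesis
    proof eventually_elim
      case (elim u)
      have "(\<Sum>l<m - 1. u (l, j)) = u (0, j) + (\<Sum>l\<in>{..<m - 1} - {0}. u (l, j))"
        using assms by (intro sum.remove) auto
      then show ?case using elim False ij by (simp add: index_mat_of_free)
    qed
  qed
  then have "AE u in free_lebesgue m n. \<forall>i\<in>{..<m}. \<forall>j\<in>{..<n}. mat_of_free m n u $$ (i, j) \<noteq> 0"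
    by (intro AE_finite_allI) auto
  then show ?thesis by eventually_elim auto
qed

section \<open>The measure on the space of parameter matrices\<close>

definition param_measure :: "nat \<Rightarrow> nat \<Rightarrow> nat \<Rightarrow> real set \<Rightarrow>
    ((nat \<times> nat \<Rightarrow> real) \<times> (nat \<times> nat \<Rightarrow> real)) measure" where
  "param_measure M H N K =
     restrict_space (free_lebesgue M H \<Otimes>\<^sub>M free_lebesgue H N) (free_domain M H K \<times> free_domain H N K)"

text \<open>Integrability over the product is part of \<open>zeta_converges\<close>, so Fubini turns
  the iterated integral into one over the product.\<close>

lemma is_RLCT_largest_zeta_pole:
  assumes "compact K" "is_RLCT M H N K f lam"
  shows "largest_zeta_pole (param_measure M H N K) (\<lambda>(u, v). f (mat_of_free M H u) (mat_of_free H N v)) lam"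
proof -
  interpret pair_sigma_finite "free_lebesgue M H" "free_lebesgue H N"
    by (intro pair_sigma_finite.intro sigma_finite_free_lebesgue)
  let ?D = "free_domain M H K \<times> free_domain H N K"
  let ?P = "free_lebesgue M H \<Otimes>\<^sub>M free_lebesgue H N"
  let ?f = "\<lambda>(u, v). f (mat_of_free M H u) (mat_of_free H N v)"
  have D: "?D \<inter> space ?P \<in> sets ?P"
    using free_domain_sets[OF assms(1)] by (intro sets.Int) auto
  have int: "zeta_converges M H N K f s \<longleftrightarrow> integrable (param_measure M H N K) (\<lambda>x. complex_of_real (?f x) powr s)" for s
    unfolding zeta_converges_def set_integrable_def param_measure_def integrable_restrict_space[OF D]
    by (simp add: case_prod_unfold)
  have eq: "zeta_integral M H N K f s = (\<integral>x. complex_of_real (?f x) powr s \<partial>param_measure M H N K)"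
    if "zeta_converges M H N K f s" for s
  proof -
    define h where "h = (\<lambda>(u, v). indicator ?D (u, v) *\<^sub>R
       (complex_of_real (f (mat_of_free M H u) (mat_of_free H N v)) powr s))"
    have "integrable ?P h"
      using that unfolding zeta_converges_def set_integrable_def h_def by (simp add: case_prod_unfold)
    then have "integral\<^sup>L ?P h = (\<integral>u. (\<integral>v. h (u, v) \<partial>free_lebesgue H N) \<partial>free_lebesgue M H)"
      by (rule integral_fst'[symmetric])
    also have "\<dots> = zeta_integral M H N K f s"
      unfolding zeta_integral_def set_lebesgue_integral_def h_def
      by (simp add: indicator_times flip: scaleR_scaleR)
    finally show ?thesis
      unfolding param_measure_def integral_restrict_space[OF D] h_def by (simp add: case_prod_unfold)
  qed
  obtain Z where Z: "Z meromorphic_on UNIV" "is_pole Z (complex_of_real (- lam))"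
    "\<forall>p. is_pole Z p \<longrightarrow> Re p \<le> - lam"
    "\<And>s. 0 < Re s \<Longrightarrow> zeta_converges M H N K f s"
    "\<And>s. 0 < Re s \<Longrightarrow> Z s = zeta_integral M H N K f s"
    using assms(2) unfolding is_RLCT_def by blast
  have "integrable (param_measure M H N K) (\<lambda>x. complex_of_real (?f x) powr s)"
    "Z s = (\<integral>x. complex_of_real (?f x) powr s \<partial>param_measure M H N K)" if "0 < Re s" for s
    using Z(4)[OF that] Z(5)[OF that] int[of s] eq[of s] by simp_all
  then show ?thesis
    unfolding largest_zeta_pole_def using Z(1-3) by blast
qed

lemma finite_measure_param_measure:
  assumes "compact K"
  shows "finite_measure (param_measure M H N K)"
proof (rule finite_measureI)
  interpret pair_sigma_finite "free_lebesgue M H" "free_lebesgue H N"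
    by (intro pair_sigma_finite.intro sigma_finite_free_lebesgue)
  let ?D = "free_domain M H K \<times> free_domain H N K"
  let ?P = "free_lebesgue M H \<Otimes>\<^sub>M free_lebesgue H N"
  have sets: "free_domain M H K \<in> sets (free_lebesgue M H)" "free_domain H N K \<in> sets (free_lebesgue H N)"
    using free_domain_sets[OF assms] by auto
  then have D: "?D \<in> sets ?P" by auto
  have "emeasure (param_measure M H N K) (space (param_measure M H N K)) = emeasure ?P ?D"
    unfolding param_measure_def using sets.sets_into_space[OF D]
    by (simp add: space_restrict_space emeasure_restrict_space D Int_absorb2)
  also have "\<dots> = emeasure (free_lebesgue M H) (free_domain M H K) * emeasure (free_lebesgue H N) (free_domain H N K)"
    using sets by (rule M2.emeasure_pair_measure_Times)
  also have "\<dots> \<le> 1 * 1" by (intro mult_mono emeasure_free_domain) auto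
  finally show "emeasure (param_measure M H N K) (space (param_measure M H N K)) \<noteq> \<infinity>"
    by (auto simp: top_unique)
qed

lemma AE_param_measure:
  assumes "compact K" "2 \<le> M"
  shows "AE x in param_measure M H N K. case x of (u, v) \<Rightarrow>
     stochastic (mat_of_free M H u) \<and> stochastic (mat_of_free H N v) \<and>
     (\<forall>i<M. \<forall>j<N. 0 < (mat_of_free M H u * mat_of_free H N v) $$ (i, j))"
proof -
  interpret pair_sigma_finite "free_lebesgue M H" "free_lebesgue H N"
    by (intro pair_sigma_finite.intro sigma_finite_free_lebesgue)
  let ?D = "free_domain M H K \<times> free_domain H N K"
  let ?P = "free_lebesgue M H \<Otimes>\<^sub>M free_lebesgue H N"
  have D: "?D \<inter> space ?P \<in> sets ?P"
    using free_domain_sets[OF assms(1)] by (intro sets.Int) auto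
  obtain S where S: "S \<in> null_sets (free_lebesgue M H)"
    "{u \<in> space (free_lebesgue M H). \<not> (\<forall>i<M. \<forall>k<H. mat_of_free M H u $$ (i, k) \<noteq> 0)} \<subseteq> S"
    using AE_mat_of_free_nonzero[OF assms(2), of H] by (auto elim!: AE_E intro: null_setsI)
  \<comment> \<open>The exceptional set restricts \<open>A\<close> alone, so it lies in a cylinder
    over a null set.\<close>
  have "S \<times> space (free_lebesgue H N) \<in> null_sets ?P"
    using S(1) by (intro M2.times_in_null_sets1) auto
  then have "AE x in ?P. x \<notin> S \<times> space (free_lebesgue H N)"
    by (rule AE_not_in)
  moreover have "AE x in ?P. x \<in> space ?P" by (rule AE_space)
  ultimately have "AE x in ?P. x \<in> ?D \<longrightarrow> (case x of (u, v) \<Rightarrow>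
     stochastic (mat_of_free M H u) \<and> stochastic (mat_of_free H N v) \<and>
     (\<forall>i<M. \<forall>j<N. 0 < (mat_of_free M H u * mat_of_free H N v) $$ (i, j)))"
  proof eventually_elim
    case (elim x)
    obtain u v where x: "x = (u, v)" by force
    have u: "mat_of_free M H u $$ (i, k) \<noteq> 0" if "i < M" "k < H" for i k
      using elim S(2) that by (auto simp: x space_pair_measure)
    show ?case
    proof (intro impI, unfold x prod.case, intro conjI allI impI)
      assume "(u, v) \<in> ?D"
      then show st: "stochastic (mat_of_free M H u)" "stochastic (mat_of_free H N v)"
        by (auto dest: free_domain_stochastic)
      show "0 < (mat_of_free M H u * mat_of_free H N v) $$ (i, j)" if "i < M" "j < N" for i j
        using u stochastic_nonneg[OF mat_of_free_carrier st(1)] that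
        by (intro mult_mat_pos[OF mat_of_free_carrier mat_of_free_carrier st(2)]) (auto simp: less_le)
    qed
  qed
  then show ?thesis unfolding param_measure_def AE_restrict_space_iff[OF D] .
qed

lemma measurable_index_mult_param:
  assumes "i < M" "j < N"
  shows "(\<lambda>x. (mat_of_free M H (fst x) * mat_of_free H N (snd x)) $$ (i, j)) \<in> borel_measurable (param_measure M H N K)"
proof -
  have fst: "fst \<in> measurable (param_measure M H N K) (free_lebesgue M H)"
    and snd: "snd \<in> measurable (param_measure M H N K) (free_lebesgue H N)"
    unfolding param_measure_def by (auto intro: measurable_restrict_space1)
  show ?thesis
    unfolding index_mult_mat_sum[OF mat_of_free_carrier mat_of_free_carrier assms]
    using assms
    by (intro borel_measurable_sum borel_measurable_times measurable_index_mat_of_free fst snd) auto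
qed

theorem theorem7:
  fixes M N H H0 :: nat
    and K K0 :: "real set"
    and A0 B0 :: "real mat"
    and q' :: "nat vec \<Rightarrow> real"
    and lam_SMF lam_LDA :: real
  assumes "2 \<le> M" and "2 \<le> N" and "1 \<le> H0" and "H0 \<le> H"
    and "compact K" and "K \<subseteq> {0..1}"
    and "compact K0" and "K0 \<subseteq> {0<..<1}"
    and "{(a, b, a0, b0). a \<in> K \<and> b \<in> K \<and> a0 \<in> K0 \<and> b0 \<in> K0 \<and> a * b = a0 * b0} \<noteq> {}"
    and "A0 \<in> stoch_mats M H0 K0" and "B0 \<in> stoch_mats H0 N K0"
    and "minimal_factorization A0 B0"
    and "\<And>z. z \<in> Onehot N \<Longrightarrow> 0 < q' z"
    and "bounded (q' ` Onehot N)"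
    and "(\<Sum>z\<in>Onehot N. q' z) = 1"
    and "is_RLCT M H N K (\<lambda>A B. sq_norm_mat (A * B - A0 * B0)) lam_SMF"
    and "is_RLCT M H N K (KL_LDA A0 B0 q') lam_LDA"
  shows "lam_SMF = lam_LDA"
proof -
  \<comment> \<open>As \<open>M \<ge> 2\<close>, the single-row exception does not apply, and the
    entries lie in \<open>K0\<close>, inside the open unit interval.\<close>
  have A0: "A0 \<in> carrier_mat M H0" "stochastic A0" "\<And>i k. i < M \<Longrightarrow> k < H0 \<Longrightarrow> 0 < A0 $$ (i, k)"
    using assms(1,8,10) unfolding stoch_mats_def by force+
  have B0: "B0 \<in> carrier_mat H0 N" "stochastic B0"
    using assms(11) by (auto simp: stoch_mats_def)
  have MN: "0 < M" "0 < N" using assms(1,2) by auto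
  obtain c C d where cCd: "0 < c" "0 < C" "0 < d" and
    cmp: "\<And>H A B. A \<in> carrier_mat M H \<Longrightarrow> B \<in> carrier_mat H N \<Longrightarrow> stochastic A \<Longrightarrow> stochastic B \<Longrightarrow>
       (\<And>i j. i < M \<Longrightarrow> j < N \<Longrightarrow> 0 < (A * B) $$ (i, j)) \<Longrightarrow>
       c * sq_norm_mat (A * B - A0 * B0) \<le> KL_LDA A0 B0 q' A B \<and>
       (sq_norm_mat (A * B - A0 * B0) < d \<longrightarrow> KL_LDA A0 B0 q' A B \<le> C * sq_norm_mat (A * B - A0 * B0))"
    using KL_LDA_comparable_sq_norm[OF MN A0 B0 assms(13,15)] by blast
  let ?\<mu> = "param_measure M H N K"
  let ?F = "\<lambda>(u, v). sq_norm_mat (mat_of_free M H u * mat_of_free H N v - A0 * B0)"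
  let ?G = "\<lambda>(u, v). KL_LDA A0 B0 q' (mat_of_free M H u) (mat_of_free H N v)"
  note meas = measurable_index_mult_param[measurable]
  have F_meas: "?F \<in> borel_measurable ?\<mu>"
    unfolding sq_norm_mat_diff_mult[OF A0(1) B0(1) mat_of_free_carrier mat_of_free_carrier] case_prod_unfold
    by (intro borel_measurable_sum borel_measurable_power borel_measurable_diff meas borel_measurable_const) auto
  have G_meas: "?G \<in> borel_measurable ?\<mu>"
    unfolding KL_LDA_altdef[OF A0(1) B0(1) mat_of_free_carrier mat_of_free_carrier] case_prod_unfold
    by (intro borel_measurable_sum borel_measurable_times borel_measurable_ln borel_measurable_divide
          meas borel_measurable_const) auto
  have ae: "AE x in ?\<mu>. c * ?F x \<le> ?G x \<and> (?F x < d \<longrightarrow> ?G x \<le> C * ?F x)"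
    using AE_param_measure[OF assms(5,1), of H N]
    by eventually_elim (use cmp[OF mat_of_free_carrier mat_of_free_carrier] in \<open>simp add: case_prod_unfold del: index_mult_mat\<close>)
  show ?thesis
  proof (rule largest_zeta_pole_unique_of_comparable[OF finite_measure_param_measure F_meas G_meas])
    show "0 \<le> ?F x" for x by (auto simp: sq_norm_mat_def case_prod_unfold intro!: sum_nonneg)
    show "AE x in ?\<mu>. c * ?F x \<le> ?G x" and "AE x in ?\<mu>. ?F x < d \<longrightarrow> ?G x \<le> C * ?F x"
      using ae by auto
    show "largest_zeta_pole ?\<mu> ?F lam_SMF"
      using is_RLCT_largest_zeta_pole[OF assms(5,16)] .
    show "largest_zeta_pole ?\<mu> ?G lam_LDA"
      using is_RLCT_largest_zeta_pole[OF assms(5,17)] .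
  qed (use cCd assms(5) in auto)
qed

end
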